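(* Let $\Sigma$ be a topological space and let $tt_1, tt_2 : \mathbb{R}_{\ge 0} \rightharpoonup \Sigma$ be partial functions such that there exist $m, n \in \mathbb{R}_{\ge 0}$ with $\mathrm{dom}(tt_1) = [0,m)$ and $\mathrm{dom}(tt_2) = [0,n)$. Then $tt_1 \in \mathbb{TT}$ and $tt_2 \in \mathbb{TT}$ if, and only if, $tt_1 \frown tt_2 \in \mathbb{TT}$.
   Context: For a partial function $f : \mathbb{R}_{\ge 0} \rightharpoonup \Sigma$ and $n \in \mathbb{R}_{\ge 0}$, the shift $f \triangleright n$ is the partial function $\lambda x.\ f(x - n)$ (defined at $x$ exactly when $x \ge n$ and $x - n \in \mathrm{dom}(f)$). $\mathrm{end}(f) = \min(\mathbb{R}_{\ge 0} \setminus \mathrm{dom}(f))$ and $f \frown g = f \cup (g \triangleright \mathrm{end}(f))$ (union of graphs). The set of timed traces $\mathbb{TT}$ consists of those $f : \mathbb{R}_{\ge 0} \rightharpoonup \Sigma$ such that there is $t \in \mathbb{R}_{\ge 0}$ with $\mathrm{dom}(f) = [0,t)$ and, if $t > 0$, there is a finite strictly increasing sequence of reals $I = \langle I_0, \dots, I_{k-1}\rangle$ with $\mathrm{ran}(I) \subseteq [0,t]$, $\{0,t\} \subseteq \mathrm{ran}(I)$, and for every $n < k-1$ and every $s \in [I_n, I_{n+1})$, $\lim_{x \to s^+} f(x) = f(s)$. *)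

theory Defs
  imports Complex_Main
begin

text \<open>
  A partial function on the nonnegative reals is a map \<open>real \<rightharpoonup> 'a\<close> whose domain is contained
  in \<open>{0..}\<close>.
\<close>

definition shift :: "(real \<rightharpoonup> 'a) \<Rightarrow> real \<Rightarrow> (real \<rightharpoonup> 'a)"  (infixl "\<triangleright>" 75)
  where "f \<triangleright> n = (\<lambda>x. if n \<le> x then f (x - n) else None)"

text \<open>
  The minimum need not exist for an arbitrary map; in that case the value is unspecified.
\<close>

definition trace_end :: "(real \<rightharpoonup> 'a) \<Rightarrow> real"
  where "trace_end f = (LEAST x. x \<in> {0..} - dom f)"

text \<open>
  Concatenation is the union of the graphs of \<open>f\<close> and \<open>g \<triangleright> trace_end f\<close>. This union is a
  function only if the two agree on the overlap of their domains; \<open>++\<close> makes the operation total.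
  For traces the domains are disjoint, see \<open>graph_trace_concat\<close> below.
\<close>

definition trace_concat :: "(real \<rightharpoonup> 'a) \<Rightarrow> (real \<rightharpoonup> 'a) \<Rightarrow> (real \<rightharpoonup> 'a)"  (infixl "\<frown>" 70)
  where "f \<frown> g = f ++ (g \<triangleright> trace_end f)"

text \<open>
  The topology need not be Hausdorff, so a right limit being equal to the value is read as
  convergence to that value.
\<close>

definition timed_traces :: "(real \<rightharpoonup> 'a::topological_space) set"
  where "timed_traces =
    {f. \<exists>t\<ge>0. dom f = {0..<t} \<and>
      (t > 0 \<longrightarrow>
        (\<exists>I :: real list. sorted_wrt (<) I \<and> set I \<subseteq> {0..t} \<and> {0, t} \<subseteq> set I \<and>
          (\<forall>n < length I - 1. \<forall>s \<in> {I ! n..<I ! (n + 1)}.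
            ((\<lambda>x. the (f x)) \<longlongrightarrow> the (f s)) (at s within dom f \<inter> {s<..}))))}"

lemma trace_end_eq:
  assumes "m \<ge> 0" "dom f = {0..<m}"
  shows "trace_end f = m"
  unfolding trace_end_def using assms by (intro Least_equality) auto

lemma graph_trace_concat:
  assumes "m \<ge> 0" "dom f = {0..<m}"
  shows "Map.graph (f \<frown> g) = Map.graph f \<union> Map.graph (g \<triangleright> trace_end f)"
proof -
  have "f x = None" if "m \<le> x" for x
    using assms(2) that by (metis atLeastLessThan_iff domIff not_le)
  then show ?thesis
    unfolding trace_concat_def trace_end_eq[OF assms] Map.graph_def
    by (auto simp: shift_def map_add_def split: option.splits if_splits)
qed

end

theory Submission imports Defs begin

text \<open>
  The intervals between consecutive points of the sequence \<open>I\<close> cover \<open>[0, t)\<close>, so the condition on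
  \<open>I\<close> amounts to right-continuity at every point of the domain, and the two-point sequence \<open>0, t\<close>
  always serves as a witness. Right-continuity is local and invariant under shifts; it holds for
  \<open>tt\<^sub>1 \<frown> tt\<^sub>2\<close> on \<open>[0, m)\<close> iff it holds for \<open>tt\<^sub>1\<close>, and on \<open>[m, m + n)\<close> iff it holds for \<open>tt\<^sub>2\<close>.
\<close>

text \<open>The index sought is the last one whose entry is at most \<open>s\<close>. The entry
  \<open>a\<close> shows that such an index exists, and \<open>b\<close> that it is not the final
  index of the list.\<close>

lemma sorted_wrt_less_consecutive_interval:
  fixes xs :: "'a::linorder list"
  assumes "sorted_wrt (<) xs" "a \<in> set xs" "b \<in> set xs" "a \<le> s" "s < b"
  obtains n where "n < length xs - 1" "s \<in> {xs ! n..<xs ! (n + 1)}"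
proof -
  define N where "N = {i. i < length xs \<and> xs ! i \<le> s}"
  define n where "n = Max N"
  obtain i where i: "i < length xs" "xs ! i = a"
    using assms(2) by (auto simp: in_set_conv_nth)
  obtain j where j: "j < length xs" "xs ! j = b"
    using assms(3) by (auto simp: in_set_conv_nth)
  have fin: "finite N" and ne: "N \<noteq> {}"
    using i assms(4) by (auto simp: N_def)
  have n: "n < length xs" "xs ! n \<le> s"
    using Max_in[OF fin ne] by (auto simp: N_def n_def)
  \<comment> \<open>This makes \<open>n + 1\<close> a valid index; being valid and beyond the
    maximum of \<open>N\<close>, it must carry an entry above \<open>s\<close>.\<close>
  have "n < j"
  proof (rule ccontr)
    assume "\<not> n < j"
    then have "b \<le> xs ! n"
      using j n(1) assms(1) by (metis linorder_neqE_nat order.refl order.strict_implies_order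
          sorted_wrt_nth_less)
    then show False using n(2) assms(5) by simp
  qed
  then have len: "n + 1 < length xs" using j by simp
  moreover have "n + 1 \<notin> N"
    using Max_ge[OF fin, of "n + 1"] by (auto simp: n_def)
  ultimately have "s < xs ! (n + 1)"
    by (auto simp: N_def)
  with n len show thesis by (intro that[of n]) auto
qed

text \<open>Both sets have the same points in \<open>{..<t}\<close>, an open neighbourhood of
  \<open>s\<close>. This removes the domain from the limits in \<open>timed_traces\<close>.\<close>

lemma at_within_Ico_greaterThan:
  fixes s t :: real
  assumes "s \<in> {0..<t}"
  shows "at s within {0..<t} \<inter> {s<..} = at_right s"
  by (rule at_within_nhd[of s "{..<t}"]) (use assms in auto)

lemma timed_traces_iff_right_continuous:
  assumes "0 \<le> t" "dom f = {0..<t}"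
  shows "f \<in> timed_traces \<longleftrightarrow>
    (\<forall>s\<in>{0..<t}. ((\<lambda>x. the (f x)) \<longlongrightarrow> the (f s)) (at_right s))"
    (is "_ \<longleftrightarrow> ?R")
proof
  assume "f \<in> timed_traces"
  then obtain t' where t': "0 \<le> t'" "dom f = {0..<t'}" and imp: "t' > 0 \<longrightarrow>
      (\<exists>I :: real list. sorted_wrt (<) I \<and> set I \<subseteq> {0..t'} \<and> {0, t'} \<subseteq> set I \<and>
        (\<forall>n < length I - 1. \<forall>s \<in> {I ! n..<I ! (n + 1)}.
          ((\<lambda>x. the (f x)) \<longlongrightarrow> the (f s)) (at s within dom f \<inter> {s<..})))"
    unfolding timed_traces_def mem_Collect_eq by (elim exE conjE)
  \<comment> \<open>Both bounds equal \<open>trace_end f\<close>, also when the domain is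
    empty.\<close>
  have [simp]: "t' = t"
    using trace_end_eq t' assms by metis
  show ?R
  proof
    fix s assume s: "s \<in> {0..<t}"
    with imp obtain I where I: "sorted_wrt (<) I" "0 \<in> set I" "t \<in> set I"
      and lim: "\<forall>n < length I - 1. \<forall>s \<in> {I ! n..<I ! (n + 1)}.
          ((\<lambda>x. the (f x)) \<longlongrightarrow> the (f s)) (at s within dom f \<inter> {s<..})"
      by auto
    obtain n where "n < length I - 1" "s \<in> {I ! n..<I ! (n + 1)}"
      by (rule sorted_wrt_less_consecutive_interval[OF I, of s]) (use s in auto)
    with lim have "((\<lambda>x. the (f x)) \<longlongrightarrow> the (f s)) (at s within dom f \<inter> {s<..})"
      by blast
    then show "((\<lambda>x. the (f x)) \<longlongrightarrow> the (f s)) (at_right s)"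
      by (simp only: assms(2) at_within_Ico_greaterThan[OF s])
  qed
next
  assume R: ?R
  have lim: "((\<lambda>x. the (f x)) \<longlongrightarrow> the (f s)) (at s within dom f \<inter> {s<..})"
    if "s \<in> {0..<t}" for s
    using R that by (simp only: assms(2) at_within_Ico_greaterThan)
  have "\<exists>I. sorted_wrt (<) I \<and> set I \<subseteq> {0..t} \<and> {0, t} \<subseteq> set I \<and>
      (\<forall>n < length I - 1. \<forall>s \<in> {I ! n..<I ! (n + 1)}.
        ((\<lambda>x. the (f x)) \<longlongrightarrow> the (f s)) (at s within dom f \<inter> {s<..}))" if "t > 0"
    \<comment> \<open>The only index to check is 0, whose interval is all of
      \<open>{0..<t}\<close>.\<close>
    by (rule exI[of _ "[0, t]"]) (use that lim in auto)
  then show "f \<in> timed_traces"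
    using assms unfolding timed_traces_def mem_Collect_eq by (intro exI[of _ t] conjI impI)
qed

lemma trace_concat_apply:
  assumes "0 \<le> m" "dom f = {0..<m}"
  shows "(f \<frown> g) x = (if x < m then f x else g (x - m))"
proof -
  have "f x = None" if "m \<le> x"
    using assms(2) that by (metis atLeastLessThan_iff domIff not_le)
  then show ?thesis
    by (auto simp: trace_concat_def trace_end_eq[OF assms] shift_def map_add_def split: option.splits)
qed

lemma dom_trace_concat:
  assumes "0 \<le> m" "dom f = {0..<m}" "0 \<le> n" "dom g = {0..<n}"
  shows "dom (f \<frown> g) = {0..<m + n}"
proof (rule set_eqI)
  fix x
  have "x \<in> dom (f \<frown> g) \<longleftrightarrow> (if x < m then x \<in> dom f else x - m \<in> dom g)"
    by (simp add: dom_def trace_concat_apply[OF assms(1,2)])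
  then show "x \<in> dom (f \<frown> g) \<longleftrightarrow> x \<in> {0..<m + n}"
    using assms by auto
qed

text \<open>Since \<open>s < m\<close> is strict, points close enough to \<open>s\<close> on the
  right still lie below \<open>m\<close>, where only \<open>f\<close> is seen.\<close>

lemma trace_concat_tendsto_left:
  assumes "0 \<le> m" "dom f = {0..<m}" "s < m"
  shows "((\<lambda>x. the ((f \<frown> g) x)) \<longlongrightarrow> the ((f \<frown> g) s)) (at_right s) \<longleftrightarrow>
    ((\<lambda>x. the (f x)) \<longlongrightarrow> the (f s)) (at_right s)"
proof -
  have "eventually (\<lambda>x. x < m) (at_right s)"
    using assms(3) by (rule order_tendstoD(2)[OF tendsto_ident_at])
  then have "eventually (\<lambda>x. the ((f \<frown> g) x) = the (f x)) (at_right s)"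
    by eventually_elim (simp add: trace_concat_apply[OF assms(1,2)])
  from tendsto_cong[OF this] show ?thesis
    using assms(3) by (simp add: trace_concat_apply[OF assms(1,2)])
qed

text \<open>All points to the right of \<open>s\<close> lie beyond \<open>m\<close>, so only the
  shifted \<open>g\<close> is seen. The case \<open>s = m\<close> is included because the limits are
  one-sided: values of \<open>f\<close> before the junction do not matter.\<close>

lemma trace_concat_tendsto_right:
  assumes "0 \<le> m" "dom f = {0..<m}" "m \<le> s"
  shows "((\<lambda>x. the ((f \<frown> g) x)) \<longlongrightarrow> the ((f \<frown> g) s)) (at_right s) \<longleftrightarrow>
    ((\<lambda>x. the (g x)) \<longlongrightarrow> the (g (s - m))) (at_right (s - m))"
proof -
  have "eventually (\<lambda>x. s < x) (at_right s)"
    by (rule eventually_at_right_less)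
  then have "eventually (\<lambda>x. the ((f \<frown> g) x) = the (g (x - m))) (at_right s)"
    by eventually_elim (use assms(3) in \<open>simp add: trace_concat_apply[OF assms(1,2)]\<close>)
  from tendsto_cong[OF this] show ?thesis
    \<comment> \<open>\<open>at_right (s - m)\<close> is the image of \<open>at_right s\<close>
      under subtraction of \<open>m\<close>, so the limit of \<open>g\<close> becomes one of
      \<open>g (x - m)\<close> as \<open>x\<close> tends to \<open>s\<close>.\<close>
    unfolding filtermap_at_right_shift[symmetric] filterlim_filtermap
    using assms(3) by (simp add: trace_concat_apply[OF assms(1,2)])
qed

theorem theorem6:
  fixes tt\<^sub>1 tt\<^sub>2 :: "real \<rightharpoonup> 'a::topological_space"
  assumes "\<exists>m\<ge>0. dom tt\<^sub>1 = {0..<m}"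
    and "\<exists>n\<ge>0. dom tt\<^sub>2 = {0..<n}"
  shows "tt\<^sub>1 \<in> timed_traces \<and> tt\<^sub>2 \<in> timed_traces \<longleftrightarrow> tt\<^sub>1 \<frown> tt\<^sub>2 \<in> timed_traces"
proof -
  obtain m where m: "0 \<le> m" "dom tt\<^sub>1 = {0..<m}" using assms(1) by blast
  obtain n where n: "0 \<le> n" "dom tt\<^sub>2 = {0..<n}" using assms(2) by blast
  let ?rc = "\<lambda>f s. ((\<lambda>x. the (f x)) \<longlongrightarrow> the (f s)) (at_right s)"
  have "tt\<^sub>1 \<frown> tt\<^sub>2 \<in> timed_traces \<longleftrightarrow> (\<forall>s\<in>{0..<m + n}. ?rc (tt\<^sub>1 \<frown> tt\<^sub>2) s)"
    using m n
    by (intro timed_traces_iff_right_continuous dom_trace_concat[OF m n] add_nonneg_nonneg)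
  \<comment> \<open>Writing the second part as a translate lets its points be indexed by the domain
    of \<open>tt\<^sub>2\<close>.\<close>
  also have "{0..<m + n} = {0..<m} \<union> (\<lambda>x. x + m) ` {0..<n}"
    using m(1) n(1) by (auto simp: add.commute)
  also have "(\<forall>s\<in>\<dots>. ?rc (tt\<^sub>1 \<frown> tt\<^sub>2) s) \<longleftrightarrow>
      (\<forall>s\<in>{0..<m}. ?rc (tt\<^sub>1 \<frown> tt\<^sub>2) s) \<and> (\<forall>s\<in>{0..<n}. ?rc (tt\<^sub>1 \<frown> tt\<^sub>2) (s + m))"
    by blast
  also have "\<dots> \<longleftrightarrow> (\<forall>s\<in>{0..<m}. ?rc tt\<^sub>1 s) \<and> (\<forall>s\<in>{0..<n}. ?rc tt\<^sub>2 s)"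
    using trace_concat_tendsto_left[OF m, of _ tt\<^sub>2] trace_concat_tendsto_right[OF m, of "_ + m" tt\<^sub>2]
    by simp
  also have "\<dots> \<longleftrightarrow> tt\<^sub>1 \<in> timed_traces \<and> tt\<^sub>2 \<in> timed_traces"
    using timed_traces_iff_right_continuous[OF m] timed_traces_iff_right_continuous[OF n] by simp
  finally show ?thesis by (rule sym)
qed

end
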